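(* Let $M\ge1$ and let $\bar Z_1,\ldots,\bar Z_{M+1}$ be the sample means in the change point model, $X_i=\bar Z_i-\bar Z_{i+1}$ for $i=1,\ldots,M$, and let $\Sigma=(\sigma_{ij})$ be the $M\times M$ matrix with $\sigma_{ii}=2$, $\sigma_{ij}=-1$ if $|i-j|=1$, and $\sigma_{ij}=0$ otherwise. Let $1\le m\le M$, let $1\le j_1<j_2<\cdots<j_{m-1}\le M$ be indices, and set $j_0=0$, $j_m=M+1$. Then for every $r\in\{0,\ldots,m-1\}$ and every integer $i$ with $j_r<i<j_{r+1}$, $$U_{mi}^{(j_1,\ldots,j_{m-1})}(\mathbf{X})=\left[\frac{j_{r+1}-j_r}{(j_{r+1}-i)(i-j_r)}\right]^{1/2}\left[\sum_{j=j_r+1}^{i}\bar Z_j-\frac{i-j_r}{j_{r+1}-j_r}\sum_{j=j_r+1}^{j_{r+1}}\bar Z_j\right].$$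
   Context: Change point model: $Z_{ij}$, $i=1,\ldots,M+1$, $j=1,\ldots,n$, are independent $N(\nu_i,\sigma^2)$, and $\bar Z_i=n^{-1}\sum_{j=1}^n Z_{ij}$. The vector $\mathbf{X}=(X_1,\ldots,X_M)'$ has covariance matrix $(\sigma^2/n)\Sigma$. The statistics $U$ are computed with $\Sigma$, i.e. without the scale factor $\sigma^2/n$. For distinct indices $i_1,\ldots,i_{m-1}$ in $\{1,\ldots,M\}$, $\mathbf{x}^{(i_1,\ldots,i_{m-1})}$ is $\mathbf{x}$ with coordinates $i_1,\ldots,i_{m-1}$ deleted, and $\Sigma_{(i_1,\ldots,i_{m-1})}$ is $\Sigma$ with those rows and columns deleted. For $j\notin\{i_1,\ldots,i_{m-1}\}$, $\boldsymbol\sigma_{(j)}^{(i_1,\ldots,i_{m-1})}$ is the $(M-m)\times1$ vector of the entries $\sigma_{jk}$ of $\Sigma$ with $k\notin\{i_1,\ldots,i_{m-1},j\}$, and $$\sigma_{(j\cdot i_1,\ldots,i_{m-1})}=\sigma_{jj}-\boldsymbol\sigma_{(j)}^{(i_1,\ldots,i_{m-1})\prime}\,\Sigma^{-1}_{(i_1,\ldots,i_{m-1},j)}\,\boldsymbol\sigma_{(j)}^{(i_1,\ldots,i_{m-1})}$$ (equal to $\sigma_{jj}$ when $m=M$). Define $$U_{mj}^{(i_1,\ldots,i_{m-1})}(\mathbf{x})=\Big(x_j-\boldsymbol\sigma_{(j)}^{(i_1,\ldots,i_{m-1})\prime}\,\Sigma^{-1}_{(i_1,\ldots,i_{m-1},j)}\,\mathbf{x}^{(i_1,\ldots,i_{m-1},j)}\Big)\Big/\sigma_{(j\cdot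 i_1,\ldots,i_{m-1})}^{1/2},$$ where the subtracted term is absent when $m=M$. *)

theory Defs
  imports
    "HOL-Probability.Probability"
    "Jordan_Normal_Form.Gauss_Jordan_Elimination"
    "Jordan_Normal_Form.DL_Submatrix"
begin

(* AFP vectors and matrices are indexed from 0.  The arguments of the functions below use the
   mathematical indices 1, ..., M; entry k (1 <= k <= M) of a vector is stored at position k - 1. *)

definition kept_positions :: "nat set \<Rightarrow> nat set" where
  "kept_positions D = {p. Suc p \<notin> D}"

definition delete_coords :: "real Matrix.vec \<Rightarrow> nat set \<Rightarrow> real Matrix.vec" where
  "delete_coords x D =
     Matrix.vec (card {p. p < dim_vec x \<and> p \<in> kept_positions D})
       (\<lambda>a. vec_index x (pick (kept_positions D) a))"

definition delete_rows_cols :: "real Matrix.mat \<Rightarrow> nat set \<Rightarrow> real Matrix.mat" where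
  "delete_rows_cols S D = submatrix S (kept_positions D) (kept_positions D)"

definition sigma_vec :: "real Matrix.mat \<Rightarrow> nat set \<Rightarrow> nat \<Rightarrow> real Matrix.vec" where
  "sigma_vec S D j = delete_coords (Matrix.row S (j - 1)) (insert j D)"

(* The row vector of regression coefficients sigma_(j)' Sigma_(D, j)^(-1) applied to y.
   If every index is deleted (m = M), all vectors involved have dimension 0 and the value is 0,
   so the corresponding terms below are absent.  mat_inverse returns None on singular matrices;
   for a positive definite S every principal submatrix is invertible. *)
definition regression_term ::
  "real Matrix.mat \<Rightarrow> nat set \<Rightarrow> nat \<Rightarrow> real Matrix.vec \<Rightarrow> real" where
  "regression_term S D j y =
     scalar_prod (sigma_vec S D j)
       (mult_mat_vec (the (mat_inverse (delete_rows_cols S (insert j D)))) y)"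

definition residual_var :: "real Matrix.mat \<Rightarrow> nat set \<Rightarrow> nat \<Rightarrow> real" where
  "residual_var S D j =
     S $$ (j - 1, j - 1) - regression_term S D j (sigma_vec S D j)"

(* D is the set of the deleted indices i_1, ..., i_(m-1); the statistic does not depend on
   their order, and the subscript m is card D + 1. *)
definition U_stat :: "real Matrix.mat \<Rightarrow> nat set \<Rightarrow> nat \<Rightarrow> real Matrix.vec \<Rightarrow> real" where
  "U_stat S D j x =
     (vec_index x (j - 1) - regression_term S D j (delete_coords x (insert j D)))
       / sqrt (residual_var S D j)"

definition Sigma_cp :: "nat \<Rightarrow> real Matrix.mat" where
  "Sigma_cp M = Matrix.mat M M
     (\<lambda>(a, b). if a = b then 2 else if a = b + 1 \<or> b = a + 1 then -1 else 0)"

definition sample_mean :: "nat \<Rightarrow> (nat \<Rightarrow> nat \<Rightarrow> 'a \<Rightarrow> real) \<Rightarrow> nat \<Rightarrow> 'a \<Rightarrow> real" where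
  "sample_mean n Z i \<omega> = (\<Sum>k=1..n. Z i k \<omega>) / real n"

definition mean_diffs ::
  "nat \<Rightarrow> nat \<Rightarrow> (nat \<Rightarrow> nat \<Rightarrow> 'a \<Rightarrow> real) \<Rightarrow> 'a \<Rightarrow> real Matrix.vec" where
  "mean_diffs M n Z \<omega> =
     Matrix.vec M (\<lambda>p. sample_mean n Z (p + 1) \<omega> - sample_mean n Z (p + 2) \<omega>)"

definition change_point_model ::
  "'a measure \<Rightarrow> nat \<Rightarrow> nat \<Rightarrow> (nat \<Rightarrow> real) \<Rightarrow> real \<Rightarrow> (nat \<Rightarrow> nat \<Rightarrow> 'a \<Rightarrow> real) \<Rightarrow> bool" where
  "change_point_model P M n \<nu> \<sigma> Z \<longleftrightarrow>
     prob_space P \<and> n \<ge> 1 \<and> \<sigma> > 0 \<and>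
     prob_space.indep_vars P (\<lambda>_. borel) (\<lambda>(i, k). Z i k) ({1..M+1} \<times> {1..n}) \<and>
     (\<forall>i\<in>{1..M+1}. \<forall>k\<in>{1..n}.
        distributed P lborel (Z i k) (\<lambda>x. ennreal (normal_density (\<nu> i) \<sigma> x)))"

end

theory Submission
  imports Defs "Jordan_Normal_Form.Determinant"
begin

text \<open>No inverse matrix is computed. If a vector \<open>w\<close> is \<open>1\<close> at \<open>j\<close>, vanishes on the other indices of
  \<open>D\<close>, and \<open>S w\<close> vanishes at all remaining indices, then by the normal equations \<open>- w\<close> restricted
  to these indices is the vector of regression coefficients, so that \<open>U\<close> is \<open>w \<bullet> x\<close> divided by the
  square root of \<open>(S w)\<^sub>j\<close>. For the tridiagonal covariance matrix, \<open>S w\<close> is a negative second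
  difference, so \<open>w\<close> is the tent function that is piecewise linear between the deleted neighbours
  of \<open>j\<close>; summation by parts turns \<open>w \<bullet> x\<close> into a difference of two block averages.\<close>

lemma bij_betw_pick:
  assumes "infinite K"
  shows "bij_betw (pick K) {..<card {p. p < M \<and> p \<in> K}} {p. p < M \<and> p \<in> K}"
proof (rule bij_betw_imageI)
  show "inj_on (pick K) {..<card {p. p < M \<and> p \<in> K}}"
    using pick_eq_iff_inf[OF assms] by (auto simp: inj_on_def)
  show "pick K ` {..<card {p. p < M \<and> p \<in> K}} = {p. p < M \<and> p \<in> K}"
  proof (intro equalityI subsetI)
    fix p assume p: "p \<in> {p. p < M \<and> p \<in> K}"
    have "{a \<in> K. a < p} \<subset> {p. p < M \<and> p \<in> K}" using p by auto
    then have "card {a \<in> K. a < p} < card {p. p < M \<and> p \<in> K}"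
      by (intro psubset_card_mono) auto
    then show "p \<in> pick K ` {..<card {p. p < M \<and> p \<in> K}}"
      using p by (intro image_eqI[where x = "card {a \<in> K. a < p}"]) (simp_all add: pick_card_in_set)
  qed (auto simp: pick_le pick_in_set_inf[OF assms])
qed

lemma infinite_kept_positions:
  assumes "finite D"
  shows "infinite (kept_positions D)"
proof -
  have "kept_positions D = - (Suc -` D)" by (auto simp: kept_positions_def)
  moreover have "finite (Suc -` D)" using assms by (simp add: finite_vimageI)
  ultimately show ?thesis by (metis finite_compl infinite_UNIV_nat)
qed

lemma regression_term_eq:
  fixes S :: "real Matrix.mat" and x :: "real Matrix.vec" and w :: "nat \<Rightarrow> real"
  assumes S: "S \<in> carrier_mat M M"
    and sym: "\<And>p q. p < M \<Longrightarrow> q < M \<Longrightarrow> S $$ (p, q) = S $$ (q, p)"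
    and definite: "\<And>u p. (\<Sum>p<M. u p * (\<Sum>q<M. S $$ (p, q) * u q)) = 0 \<Longrightarrow> p < M \<Longrightarrow> u p = 0"
    and x: "dim_vec x = M"
    and D: "finite D" and j: "1 \<le> j" "j \<le> M"
    and w_j: "w (j - 1) = 1"
    and w_D: "\<And>p. p < M \<Longrightarrow> Suc p \<in> D \<Longrightarrow> Suc p \<noteq> j \<Longrightarrow> w p = 0"
    and normal: "\<And>p. p < M \<Longrightarrow> Suc p \<notin> insert j D \<Longrightarrow> (\<Sum>q<M. S $$ (p, q) * w q) = 0"
  shows "regression_term S D j (delete_coords x (insert j D)) =
    vec_index x (j - 1) - (\<Sum>q<M. w q * vec_index x q)"
proof -
  define K where "K = kept_positions (insert j D)"
  define A where "A = {p. p < M \<and> p \<in> K}"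
  define N where "N = card A"
  define B where "B = delete_rows_cols S (insert j D)"
  define c where "c = Matrix.vec N (\<lambda>a. - w (pick K a))"
  define s where "s = sigma_vec S D j"
  define y where "y = delete_coords x (insert j D)"
  have dims: "dim_row S = M" "dim_col S = M" using S by auto
  have bij: "bij_betw (pick K) {..<N} A"
    unfolding A_def N_def K_def by (rule bij_betw_pick) (simp add: D infinite_kept_positions)
  have pick: "pick K a \<in> A" if "a < N" for a
    using bij_betwE[OF bij] that by auto
  have sum_pick: "(\<Sum>a<N. f (pick K a)) = (\<Sum>p\<in>A. f p)" for f :: "nat \<Rightarrow> real"
    by (rule sum.reindex_bij_betw[OF bij])
  have A_iff: "p \<in> A \<longleftrightarrow> p < M \<and> Suc p \<notin> insert j D" for p
    by (simp add: A_def K_def kept_positions_def)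
  have jM: "j - 1 < M" and jA: "j - 1 \<notin> A" using j by (auto simp: A_iff)
  have Bc: "B \<in> carrier_mat N N"
    by (rule carrier_matI) (simp_all add: B_def delete_rows_cols_def dim_submatrix dims N_def A_def K_def)
  have B: "B $$ (a, b) = S $$ (pick K a, pick K b)" if "a < N" "b < N" for a b
    unfolding B_def delete_rows_cols_def K_def
    by (rule submatrix_index) (use that in \<open>simp_all add: dims N_def A_def K_def\<close>)
  have sc: "s \<in> carrier_vec N"
    by (simp add: s_def sigma_vec_def delete_coords_def dims N_def A_def K_def)
  have s: "vec_index s a = S $$ (pick K a, j - 1)" if "a < N" for a
  proof -
    have "vec_index s a = S $$ (j - 1, pick K a)"
      using that pick[OF that] jM
      by (simp add: s_def sigma_vec_def delete_coords_def dims N_def A_def K_def)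
    then show ?thesis using sym[OF jM, of "pick K a"] pick[OF that] by (simp add: A_iff)
  qed
  have yc: "y \<in> carrier_vec N"
    by (simp add: y_def delete_coords_def x N_def A_def K_def)
  have y: "vec_index y a = vec_index x (pick K a)" if "a < N" for a
    using that by (simp add: y_def delete_coords_def x N_def A_def K_def)
  have cc: "c \<in> carrier_vec N" by (simp add: c_def)
  have sum_w: "(\<Sum>q<M. g q * w q) = g (j - 1) + (\<Sum>q\<in>A. g q * w q)" for g :: "nat \<Rightarrow> real"
  proof -
    have "(\<Sum>q<M. g q * w q) = (\<Sum>q\<in>insert (j - 1) A. g q * w q)"
    proof (rule sum.mono_neutral_right)
      show "\<forall>q\<in>{..<M} - insert (j - 1) A. g q * w q = 0"
      proof
        fix q assume q: "q \<in> {..<M} - insert (j - 1) A"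
        then have "Suc q \<noteq> j" by auto
        with q have "Suc q \<in> D" by (auto simp: A_iff)
        with \<open>Suc q \<noteq> j\<close> q have "w q = 0" using w_D by auto
        then show "g q * w q = 0" by simp
      qed
    qed (use jM in \<open>auto simp: A_iff\<close>)
    also have "\<dots> = g (j - 1) + (\<Sum>q\<in>A. g q * w q)"
      using jA w_j by (subst sum.insert) (simp_all add: A_def)
    finally show ?thesis .
  qed
  have B_c: "B *\<^sub>v c = s"
  proof (rule eq_vecI)
    fix a assume "a < dim_vec s"
    then have a: "a < N" using sc by simp
    have "vec_index (B *\<^sub>v c) a = (\<Sum>b<N. S $$ (pick K a, pick K b) * - w (pick K b))"
      using a Bc by (auto simp: scalar_prod_def c_def B atLeast0LessThan intro!: sum.cong)
    also have "\<dots> = (\<Sum>q\<in>A. S $$ (pick K a, q) * - w q)" by (rule sum_pick)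
    also have "\<dots> = S $$ (pick K a, j - 1) - (\<Sum>q<M. S $$ (pick K a, q) * w q)"
      by (simp add: sum_w sum_negf)
    also have "\<dots> = vec_index s a"
      using normal[of "pick K a"] pick[OF a] by (simp add: s[OF a] A_iff)
    finally show "vec_index (B *\<^sub>v c) a = vec_index s a" .
  qed (use Bc sc in auto)
  have sym_B: "Matrix.transpose_mat B = B"
    using Bc pick sym by (intro eq_matI) (auto simp: B A_iff)
  have "Determinant.det B \<noteq> 0"
  proof
    assume "Determinant.det B = 0"
    then obtain v where v: "v \<in> carrier_vec N" "v \<noteq> 0\<^sub>v N" "B *\<^sub>v v = 0\<^sub>v N"
      using det_0_iff_vec_prod_zero_field[OF Bc] by blast
    define u where "u p = (if p \<in> A then vec_index v (the_inv_into {..<N} (pick K) p) else 0)" for p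
    have u_pick: "u (pick K a) = vec_index v a" if "a < N" for a
      using pick[OF that] that the_inv_into_f_f[OF bij_betw_imp_inj_on[OF bij], of a]
      by (simp add: u_def)
    have sum_u: "(\<Sum>q<M. g q * u q) = (\<Sum>a<N. g (pick K a) * vec_index v a)"
      for g :: "nat \<Rightarrow> real"
    proof -
      have "(\<Sum>q<M. g q * u q) = (\<Sum>q\<in>A. g q * u q)"
        by (rule sum.mono_neutral_right) (auto simp: A_iff u_def)
      then show ?thesis by (simp add: sum_pick[symmetric] u_pick)
    qed
    have "(\<Sum>q<M. S $$ (pick K a, q) * u q) = 0" if a: "a < N" for a
    proof -
      have "(\<Sum>q<M. S $$ (pick K a, q) * u q) = vec_index (B *\<^sub>v v) a"
        unfolding sum_u using a Bc v(1)
        by (auto simp: scalar_prod_def B atLeast0LessThan intro!: sum.cong)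
      then show ?thesis using v(3) a by simp
    qed
    then have "(\<Sum>p<M. u p * (\<Sum>q<M. S $$ (p, q) * u q)) = 0"
      using sum_u[of "\<lambda>p. \<Sum>q<M. S $$ (p, q) * u q"] by (simp add: mult.commute)
    then have "u p = 0" if "p < M" for p using definite that by blast
    then have "vec_index v a = 0" if "a < N" for a
      using u_pick[OF that] pick[OF that] by (simp add: A_iff)
    then have "v = 0\<^sub>v N" using v(1) by (intro eq_vecI) auto
    with v(2) show False by simp
  qed
  then obtain B' where B': "mat_inverse B = Some B'"
    using mat_inverse(1)[OF Bc, where b = "()"] det_non_zero_imp_unit[OF Bc, where b = "()"]
    by (cases "mat_inverse B") auto
  from mat_inverse(2)[OF Bc B'] have inv: "B * B' = 1\<^sub>m N" and B'c: "B' \<in> carrier_mat N N" by auto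
  have "regression_term S D j y = s \<bullet> (B' *\<^sub>v y)"
    by (simp add: regression_term_def B' s_def flip: B_def)
  also have "\<dots> = (Matrix.transpose_mat B *\<^sub>v c) \<bullet> (B' *\<^sub>v y)" by (simp add: sym_B B_c)
  also have "\<dots> = c \<bullet> (B *\<^sub>v (B' *\<^sub>v y))"
    using Bc B'c cc yc by (intro transpose_vec_mult_scalar) auto
  also have "B *\<^sub>v (B' *\<^sub>v y) = y"
    using assoc_mult_mat_vec[OF Bc B'c yc] inv yc by simp
  also have "c \<bullet> y = (\<Sum>a<N. - (vec_index x (pick K a) * w (pick K a)))"
    using yc by (auto simp: scalar_prod_def c_def y atLeast0LessThan intro!: sum.cong)
  also have "\<dots> = - (\<Sum>q\<in>A. vec_index x q * w q)"
    by (simp only: sum_negf sum_pick[of "\<lambda>q. vec_index x q * w q"])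
  also have "\<dots> = vec_index x (j - 1) - (\<Sum>q<M. w q * vec_index x q)"
    using sum_w[of "vec_index x"] by (simp add: mult.commute)
  finally show ?thesis by (simp add: y_def)
qed

lemma U_stat_eq:
  fixes S :: "real Matrix.mat" and x :: "real Matrix.vec" and w :: "nat \<Rightarrow> real"
  assumes S: "S \<in> carrier_mat M M"
    and sym: "\<And>p q. p < M \<Longrightarrow> q < M \<Longrightarrow> S $$ (p, q) = S $$ (q, p)"
    and definite: "\<And>u p. (\<Sum>p<M. u p * (\<Sum>q<M. S $$ (p, q) * u q)) = 0 \<Longrightarrow> p < M \<Longrightarrow> u p = 0"
    and x: "dim_vec x = M"
    and D: "finite D" and j: "1 \<le> j" "j \<le> M"
    and w_j: "w (j - 1) = 1"
    and w_D: "\<And>p. p < M \<Longrightarrow> Suc p \<in> D \<Longrightarrow> Suc p \<noteq> j \<Longrightarrow> w p = 0"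
    and normal: "\<And>p. p < M \<Longrightarrow> Suc p \<notin> insert j D \<Longrightarrow> (\<Sum>q<M. S $$ (p, q) * w q) = 0"
  shows "U_stat S D j x =
    (\<Sum>q<M. w q * vec_index x q) / sqrt (\<Sum>q<M. S $$ (j - 1, q) * w q)"
proof -
  have regression: "regression_term S D j (delete_coords y (insert j D)) =
      vec_index y (j - 1) - (\<Sum>q<M. w q * vec_index y q)" if "dim_vec y = M" for y
    by (rule regression_term_eq; fact S sym definite that D j w_j w_D normal)
  have "j - 1 < M" using j by linarith
  then have "residual_var S D j = (\<Sum>q<M. S $$ (j - 1, q) * w q)"
    using regression[of "Matrix.row S (j - 1)"] S
    by (auto simp: residual_var_def sigma_vec_def mult.commute intro!: sum.cong)
  then show ?thesis
    using regression[OF x] by (simp add: U_stat_def)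
qed

lemma Sigma_cp_mult:
  fixes v :: "nat \<Rightarrow> real"
  assumes "p < M" "v 0 = 0" "v (Suc M) = 0"
  shows "(\<Sum>q<M. Sigma_cp M $$ (p, q) * v (Suc q)) = (v (Suc p) - v p) - (v (Suc (Suc p)) - v (Suc p))"
proof -
  have "(\<Sum>q<M. Sigma_cp M $$ (p, q) * v (Suc q)) =
    (\<Sum>q<M. (if q = p then 2 * v (Suc p) else 0) - (if q = Suc p then v (Suc (Suc p)) else 0)
      - (if q = p - 1 then v p else 0))"
    using assms by (cases p; intro sum.cong) (auto simp: Sigma_cp_def)
  also have "\<dots> = 2 * v (Suc p) - (if Suc p < M then v (Suc (Suc p)) else 0) - v p"
    using assms(1) by (auto simp: sum_subtractf sum.delta)
  also have "(if Suc p < M then v (Suc (Suc p)) else 0) = v (Suc (Suc p))"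
    using assms by (cases "Suc p = M") auto
  finally show ?thesis by simp
qed

lemma summation_by_parts:
  fixes v z :: "nat \<Rightarrow> real"
  assumes "v 0 = 0" "v (Suc M) = 0"
  shows "(\<Sum>p<M. v (Suc p) * (z p - z (Suc p))) = (\<Sum>p\<le>M. (v (Suc p) - v p) * z p)"
proof -
  have "(\<Sum>p<L. v (Suc p) * (z p - z (Suc p))) = (\<Sum>p<L. (v (Suc p) - v p) * z p) - v L * z L" for L
    by (induction L) (simp_all add: assms(1) algebra_simps)
  then show ?thesis by (simp add: assms(2) algebra_simps flip: lessThan_Suc_atMost)
qed

text \<open>Summation by parts turns the quadratic form into \<open>\<Sum>\<^sub>k (u\<^sub>k\<^sub>+\<^sub>1 - u\<^sub>k)\<^sup>2\<close> with \<open>u\<^sub>0 = 0\<close>.\<close>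

lemma Sigma_cp_definite:
  fixes u :: "nat \<Rightarrow> real"
  assumes "(\<Sum>p<M. u p * (\<Sum>q<M. Sigma_cp M $$ (p, q) * u q)) = 0" and "p < M"
  shows "u p = 0"
proof -
  define v where "v k = (if k = 0 \<or> M < k then 0 else u (k - 1))" for k
  have v_Suc: "v (Suc q) = u q" if "q < M" for q using that by (simp add: v_def)
  have v0: "v 0 = 0" "v (Suc M) = 0" by (simp_all add: v_def)
  have "0 = (\<Sum>p<M. v (Suc p) * (\<Sum>q<M. Sigma_cp M $$ (p, q) * v (Suc q)))"
    using assms(1) by (simp add: v_Suc)
  also have "\<dots> = (\<Sum>p<M. v (Suc p) * ((v (Suc p) - v p) - (v (Suc (Suc p)) - v (Suc p))))"
    using v0 by (intro sum.cong) (simp_all add: Sigma_cp_mult)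
  also have "\<dots> = (\<Sum>p\<le>M. (v (Suc p) - v p)\<^sup>2)"
    using summation_by_parts[OF v0, of "\<lambda>p. v (Suc p) - v p"] by (simp add: power2_eq_square)
  finally have step: "v (Suc k) = v k" if "k \<le> M" for k
    using that by (auto simp: sum_nonneg_eq_0_iff dest!: sym[of 0])
  have "v k = 0" if "k \<le> M" for k
    using that by (induction k) (simp_all add: v0 step)
  then show ?thesis using v_Suc[OF assms(2)] assms(2) by (metis Suc_leI)
qed

definition tent :: "nat \<Rightarrow> nat \<Rightarrow> nat \<Rightarrow> nat \<Rightarrow> real" where
  "tent a i b k =
    (if k \<le> a then 0
     else if k \<le> i then (real k - real a) / (real i - real a)
     else if k < b then (real b - real k) / (real b - real i)
     else 0)"

lemma tent_diff:
  assumes "a < i" "i < b"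
  shows "tent a i b (Suc p) - tent a i b p =
    (if p \<in> {a..<i} then 1 / (real i - real a) else 0)
    - (if p \<in> {i..<b} then 1 / (real b - real i) else 0)"
proof -
  consider "p < a" | "a \<le> p" "p < i" | "i \<le> p" "p < b" | "b \<le> p" by linarith
  then show ?thesis
  proof cases
    case 2
    with assms show ?thesis by (cases "p = a") (auto simp: tent_def field_simps)
  next
    case 3
    show ?thesis
    proof (cases "p = i \<or> Suc p = b")
      case True
      with 3 assms show ?thesis by (cases "p = i"; cases "Suc p = b") (auto simp: tent_def field_simps)
    next
      case False
      with 3 assms show ?thesis by (simp add: tent_def flip: diff_divide_distrib)
    qed
  qed (use assms in \<open>auto simp: tent_def\<close>)
qed

lemma sum_tent:
  fixes z :: "nat \<Rightarrow> real"
  assumes "a < i" "i < b" "b \<le> Suc M"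
  shows "(\<Sum>p<M. tent a i b (Suc p) * (z (Suc p) - z (Suc (Suc p)))) =
    (\<Sum>k=a+1..i. z k) / (real i - real a) - (\<Sum>k=i+1..b. z k) / (real b - real i)"
proof -
  have shift: "(\<Sum>k=c+1..d. z k) = (\<Sum>p\<in>{c..<d}. z (Suc p))" for c d
    using sum.shift_bounds_Suc_ivl[of z c d] by (simp add: atLeastLessThanSuc_atLeastAtMost)
  have "(\<Sum>p<M. tent a i b (Suc p) * (z (Suc p) - z (Suc (Suc p)))) =
    (\<Sum>p\<le>M. (tent a i b (Suc p) - tent a i b p) * z (Suc p))"
    by (rule summation_by_parts) (use assms in \<open>auto simp: tent_def\<close>)
  also have "\<dots> = (\<Sum>p\<le>M. (if p \<in> {a..<i} then z (Suc p) / (real i - real a) else 0)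
      - (if p \<in> {i..<b} then z (Suc p) / (real b - real i) else 0))"
    by (intro sum.cong refl) (simp add: tent_diff[OF assms(1,2)])
  also have "\<dots> = (\<Sum>p\<in>{a..<i}. z (Suc p) / (real i - real a))
      - (\<Sum>p\<in>{i..<b}. z (Suc p) / (real b - real i))"
  proof -
    have "{..M} \<inter> {a..<i} = {a..<i}" "{..M} \<inter> {i..<b} = {i..<b}" using assms by auto
    then show ?thesis
      by (simp only: sum_subtractf sum.inter_restrict[OF finite_atMost, symmetric])
  qed
  finally show ?thesis by (simp only: shift sum_divide_distrib)
qed

lemma U_stat_Sigma_cp:
  fixes z :: "nat \<Rightarrow> real"
  assumes ab: "a < i" "i < b" "b \<le> Suc M"
    and D: "finite D" "a = 0 \<or> a \<in> D" "b = Suc M \<or> b \<in> D" "\<And>d. d \<in> D \<Longrightarrow> d \<le> a \<or> b \<le> d"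
  shows "U_stat (Sigma_cp M) D i (Matrix.vec M (\<lambda>p. z (Suc p) - z (Suc (Suc p)))) =
    sqrt ((real b - real a) / ((real b - real i) * (real i - real a))) *
      ((\<Sum>k=a+1..i. z k) - (real i - real a) / (real b - real a) * (\<Sum>k=a+1..b. z k))"
proof -
  define t where "t = tent a i b"
  define s1 s2 where "s1 = (\<Sum>k=a+1..i. z k)" and "s2 = (\<Sum>k=i+1..b. z k)"
  define l r where "l = real i - real a" and "r = real b - real i"
  have lr: "l > 0" "r > 0" using ab by (auto simp: l_def r_def)
  have t0: "t 0 = 0" "t (Suc M) = 0" using ab by (auto simp: t_def tent_def)
  have Sigma_t: "(\<Sum>q<M. Sigma_cp M $$ (p, q) * t (Suc q)) =
      (t (Suc p) - t p) - (t (Suc (Suc p)) - t (Suc p))" if "p < M" for p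
    using Sigma_cp_mult[of p M t] that t0 by simp
  have normal: "(\<Sum>q<M. Sigma_cp M $$ (p, q) * t (Suc q)) = 0"
    if p: "p < M" "Suc p \<notin> insert i D" for p
  proof -
    have "Suc p \<noteq> i" "Suc p \<noteq> a" "Suc p \<noteq> b" using p D(2,3) by auto
    then have "Suc p \<in> {a..<i} \<longleftrightarrow> p \<in> {a..<i}" "Suc p \<in> {i..<b} \<longleftrightarrow> p \<in> {i..<b}"
      using ab by auto
    then have "t (Suc p) - t p = t (Suc (Suc p)) - t (Suc p)"
      unfolding t_def tent_diff[OF ab(1,2)] by simp
    then show ?thesis by (simp add: Sigma_t[OF p(1)])
  qed
  have i: "1 \<le> i" "i \<le> M" using ab by auto
  have var: "(\<Sum>q<M. Sigma_cp M $$ (i - 1, q) * t (Suc q)) = 1 / l + 1 / r"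
  proof -
    obtain h where h: "i = Suc h" using i by (cases i) auto
    have "t (Suc h) - t h = 1 / l" "t (Suc (Suc h)) - t (Suc h) = - 1 / r"
      using ab unfolding t_def tent_diff[OF ab(1,2)] by (auto simp: h l_def r_def)
    then show ?thesis using i Sigma_t[of h] by (simp add: h)
  qed
  have "U_stat (Sigma_cp M) D i (Matrix.vec M (\<lambda>p. z (Suc p) - z (Suc (Suc p)))) =
    (\<Sum>q<M. t (Suc q) * vec_index (Matrix.vec M (\<lambda>p. z (Suc p) - z (Suc (Suc p)))) q)
      / sqrt (\<Sum>q<M. Sigma_cp M $$ (i - 1, q) * t (Suc q))"
  proof (rule U_stat_eq)
    fix p assume "Suc p \<in> D"
    then show "t (Suc p) = 0" using D(4)[of "Suc p"] ab by (auto simp: t_def tent_def)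
  qed (use i ab D(1) normal Sigma_cp_definite in \<open>auto simp: Sigma_cp_def t_def tent_def\<close>)
  also have "\<dots> = (s1 / l - s2 / r) / sqrt (1 / l + 1 / r)"
    unfolding var using sum_tent[OF ab, of z] by (simp add: s1_def s2_def l_def r_def flip: t_def)
  also have "\<dots> = sqrt (1 / l + 1 / r) * ((s1 / l - s2 / r) / (1 / l + 1 / r))"
  proof -
    have "x / sqrt V = sqrt V * (x / V)" if "V \<ge> 0" for x V :: real
      using sqrt_divide_self_eq[OF that] by (metis divide_inverse mult.left_commute)
    then show ?thesis using lr by simp
  qed
  also have "1 / l + 1 / r = (l + r) / (r * l)" using lr by (simp add: field_simps)
  also have "(s1 / l - s2 / r) / ((l + r) / (r * l)) = s1 - l / (l + r) * (s1 + s2)"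
    using lr by (simp add: divide_simps) (simp add: algebra_simps)
  also have "s1 + s2 = (\<Sum>k=a+1..b. z k)"
    using ab sum.ub_add_nat[of "a + 1" i z "b - i"] by (simp add: s1_def s2_def)
  also have "l + r = real b - real a" by (simp add: l_def r_def)
  finally show ?thesis by (simp add: s1_def l_def r_def)
qed

theorem theorem6p1:
  fixes P :: "'a measure" and M n m r i :: nat and \<nu> :: "nat \<Rightarrow> real" and \<sigma> :: real
    and Z :: "nat \<Rightarrow> nat \<Rightarrow> 'a \<Rightarrow> real" and j :: "nat \<Rightarrow> nat"
  assumes "M \<ge> 1"
    and "change_point_model P M n \<nu> \<sigma> Z"
    and "1 \<le> m" and "m \<le> M"
    and "\<forall>k\<in>{1..<m}. 1 \<le> j k \<and> j k \<le> M"
    and "strict_mono_on {1..<m} j"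
    and "j 0 = 0" and "j m = M + 1"
    and "r < m"
    and "j r < i" and "i < j (r + 1)"
  shows "\<forall>\<omega>\<in>space P.
    U_stat (Sigma_cp M) (j ` {1..<m}) i (mean_diffs M n Z \<omega>) =
      sqrt ((real (j (r + 1)) - real (j r)) /
            ((real (j (r + 1)) - real i) * (real i - real (j r)))) *
      ((\<Sum>k=j r + 1..i. sample_mean n Z k \<omega>)
       - (real i - real (j r)) / (real (j (r + 1)) - real (j r)) *
         (\<Sum>k=j r + 1..j (r + 1). sample_mean n Z k \<omega>))"
proof
  fix \<omega> assume "\<omega> \<in> space P"
  have le: "j k \<le> j l" if "k \<le> l" "l \<le> m" for k l
  proof (cases "k = 0 \<or> k = l \<or> l = m")
    case True
    moreover have "j k \<le> M + 1"
    proof (cases "k \<in> {1..<m}")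
      case True
      with assms(5) have "j k \<le> M" by blast
      then show ?thesis by simp
    next
      case False
      with that have "k = 0 \<or> k = m" by auto
      with assms(7,8) show ?thesis by auto
    qed
    ultimately show ?thesis using assms(7,8) by auto
  next
    case False
    with that have "k \<in> {1..<m}" "l \<in> {1..<m}" "k < l" by auto
    then show ?thesis using strict_mono_onD[OF assms(6)] by (simp add: less_imp_le)
  qed
  have "U_stat (Sigma_cp M) (j ` {1..<m}) i
      (Matrix.vec M (\<lambda>p. sample_mean n Z (Suc p) \<omega> - sample_mean n Z (Suc (Suc p)) \<omega>)) =
      sqrt ((real (j (r + 1)) - real (j r)) /
            ((real (j (r + 1)) - real i) * (real i - real (j r)))) *
      ((\<Sum>k=j r + 1..i. sample_mean n Z k \<omega>)
       - (real i - real (j r)) / (real (j (r + 1)) - real (j r)) *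
         (\<Sum>k=j r + 1..j (r + 1). sample_mean n Z k \<omega>))"
  proof (rule U_stat_Sigma_cp)
    show "j (r + 1) \<le> Suc M" using le[of "r + 1" m] assms(8,9) by simp
    show "j r = 0 \<or> j r \<in> j ` {1..<m}" using assms(7,9) by (cases "r = 0") auto
    show "j (r + 1) = Suc M \<or> j (r + 1) \<in> j ` {1..<m}"
      using assms(8,9) by (cases "r + 1 = m") auto
    fix d assume "d \<in> j ` {1..<m}"
    then obtain k where k: "k < m" "d = j k" by auto
    then show "d \<le> j r \<or> j (r + 1) \<le> d"
      using le[of k r] le[of "r + 1" k] assms(9) by (cases "k \<le> r") auto
  qed (use assms in auto)
  then show "U_stat (Sigma_cp M) (j ` {1..<m}) i (mean_diffs M n Z \<omega>) =
      sqrt ((real (j (r + 1)) - real (j r)) /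
            ((real (j (r + 1)) - real i) * (real i - real (j r)))) *
      ((\<Sum>k=j r + 1..i. sample_mean n Z k \<omega>)
       - (real i - real (j r)) / (real (j (r + 1)) - real (j r)) *
         (\<Sum>k=j r + 1..j (r + 1). sample_mean n Z k \<omega>))"
    by (simp add: mean_diffs_def)
qed

end
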